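(* If $G$ is a finite simple undirected $(P_6,\text{bull})$-free graph that has an efficient dominating set, then its square $G^2$ is odd-antihole-free.
   Context: All graphs are finite, undirected and simple. A vertex dominates itself and its neighbors. A set $D\subseteq V$ is an efficient dominating set of $G=(V,E)$ if every vertex of $G$ is dominated by exactly one vertex of $D$. The square $G^2=(V,E^2)$ has $uv\in E^2$ iff $d_G(u,v)\in\{1,2\}$. $P_k$ is the chordless path on $k$ vertices; the bull is the 5-vertex graph consisting of a triangle together with two pendant (degree one) vertices attached to two different vertices of the triangle. $(P_6,\text{bull})$-free means having no induced subgraph isomorphic to $P_6$ or to the bull. Odd-antihole-free means having no induced subgraph isomorphic to the complement $\overline{C_{2k+1}}$ of a chordless cycle on $2k+1$ vertices, $k\ge 2$. *)

theory Defs
  imports "Graph_Theory.Graph_Theory"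
begin

text \<open>
  A finite simple undirected graph is a \<^locale>\<open>pair_graph\<close>: a finite, loop-free, symmetric
  digraph whose arcs are ordered pairs of vertices, so that each undirected edge is
  represented by its two orientations.
\<close>

definition vert_dominates :: "'a pair_pre_digraph \<Rightarrow> 'a \<Rightarrow> 'a \<Rightarrow> bool" where
  "vert_dominates G d v \<longleftrightarrow> v = d \<or> (d, v) \<in> parcs G"

definition efficient_dominating_set :: "'a pair_pre_digraph \<Rightarrow> 'a set \<Rightarrow> bool" where
  "efficient_dominating_set G D \<longleftrightarrow>
     D \<subseteq> pverts G \<and> (\<forall>v \<in> pverts G. \<exists>!d. d \<in> D \<and> vert_dominates G d v)"

text \<open>The least number of edges on a walk, infinite if there is no walk.\<close>

definition graph_dist :: "'a pair_pre_digraph \<Rightarrow> 'a \<Rightarrow> 'a \<Rightarrow> ereal" where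
  "graph_dist G u v = wf_digraph.\<mu> (with_proj G) (\<lambda>_. 1) u v"

definition graph_square :: "'a pair_pre_digraph \<Rightarrow> 'a pair_pre_digraph" where
  "graph_square G = \<lparr> pverts = pverts G,
     parcs = {(u, v). u \<in> pverts G \<and> v \<in> pverts G \<and> graph_dist G u v \<in> {1, 2}} \<rparr>"

definition graph_complement :: "'a pair_pre_digraph \<Rightarrow> 'a pair_pre_digraph" where
  "graph_complement G = \<lparr> pverts = pverts G,
     parcs = {(u, v). u \<in> pverts G \<and> v \<in> pverts G \<and> u \<noteq> v \<and> (u, v) \<notin> parcs G} \<rparr>"

definition path_graph :: "nat \<Rightarrow> nat pair_pre_digraph" where
  "path_graph k = \<lparr> pverts = {..<k},
     parcs = {(i, j). i < k \<and> j < k \<and> (j = Suc i \<or> i = Suc j)} \<rparr>"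

text \<open>A cycle only for \<open>n \<ge> 3\<close>.\<close>

definition cycle_graph :: "nat \<Rightarrow> nat pair_pre_digraph" where
  "cycle_graph n = \<lparr> pverts = {..<n},
     parcs = {(i, j). i < n \<and> j < n \<and> (j = Suc i mod n \<or> i = Suc j mod n)} \<rparr>"

text \<open>Triangle \<open>0, 1, 2\<close>, with \<open>3\<close> pendant at \<open>0\<close> and \<open>4\<close> pendant at \<open>1\<close>.\<close>

definition bull_graph :: "nat pair_pre_digraph" where
  "bull_graph = \<lparr> pverts = {..<5},
     parcs = (let E = {(0, 1), (1, 2), (0, 2), (0, 3), (1, 4)} in E \<union> E\<inverse>) \<rparr>"

definition contains_induced :: "'a pair_pre_digraph \<Rightarrow> 'b pair_pre_digraph \<Rightarrow> bool" where
  "contains_induced G H \<longleftrightarrow>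
     (\<exists>K. induced_subgraph K (with_proj G) \<and> digraph_iso K (with_proj H))"

definition P6_bull_free :: "'a pair_pre_digraph \<Rightarrow> bool" where
  "P6_bull_free G \<longleftrightarrow>
     \<not> contains_induced G (path_graph 6) \<and> \<not> contains_induced G bull_graph"

definition odd_antihole_free :: "'a pair_pre_digraph \<Rightarrow> bool" where
  "odd_antihole_free G \<longleftrightarrow>
     (\<forall>k \<ge> 2. \<not> contains_induced G (graph_complement (cycle_graph (2 * k + 1))))"

end

theory Submission
  imports Defs
begin

text \<open>
  Colour each vertex with the vertex of the efficient dominating set that dominates it. Around an
  odd antihole of the square, consecutive vertices are at distance at least \<open>3\<close> and so have
  different colours, while all other pairs have a common neighbour (in the reflexive sense). Induced
  paths and bulls formed by antihole vertices, dominators and common neighbours restrict the colour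
  sequence: no four consecutive colours are distinct; a pattern \<open>abcb\<close> with \<open>a \<noteq> c\<close> cannot be
  continued on both sides; \<open>abcabca\<close> and \<open>ababc\<close> do not occur. For length at least \<open>7\<close> the
  colours would therefore alternate, which parity forbids, or have period \<open>3\<close>, which gives
  \<open>abcabca\<close>. For length \<open>5\<close> every colouring contains \<open>ababc\<close> or four distinct consecutive colours.
\<close>

section \<open>Induced copies as embeddings of vertices\<close>

text \<open>The subgraph of \<open>G\<close> on the image of \<open>g\<close>, with all arcs of
  \<open>G\<close> inside that image, is the required copy.\<close>

lemma contains_inducedI:
  assumes G: "pair_wf_digraph G" and H: "pair_wf_digraph H"
    and inj: "inj_on g (pverts H)" and sub: "g ` pverts H \<subseteq> pverts G"
    and arcs: "\<And>i j. \<lbrakk>i \<in> pverts H; j \<in> pverts H\<rbrakk> \<Longrightarrow> (g i, g j) \<in> parcs G \<longleftrightarrow> (i, j) \<in> parcs H"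
  shows "contains_induced G H"
proof -
  interpret G: pair_wf_digraph G by (fact G)
  interpret H: pair_wf_digraph H by (fact H)
  define V where "V = g ` pverts H"
  define K where "K = with_proj \<lparr>pverts = V, parcs = {e \<in> parcs G. fst e \<in> V \<and> snd e \<in> V}\<rparr>"
  define h where "h = the_inv_into (pverts H) g"
  have hg: "h (g i) = i" if "i \<in> pverts H" for i
    using the_inv_into_f_f[OF inj that] by (simp add: h_def)
  have wf: "wf_digraph K"
    by unfold_locales (auto simp: K_def)
  have "induced_subgraph K (with_proj G)"
    unfolding induced_subgraph_def subgraph_def compatible_def
    using wf G.wf_digraph_axioms sub by (auto simp: K_def V_def)
  moreover have "digraph_iso K (with_proj H)"
    unfolding digraph_iso_def
  proof (intro exI conjI)
    \<comment> \<open>The isomorphism runs from the copy \<open>K\<close> back to \<open>H\<close>,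
      so it is built from the inverse \<open>h\<close> of \<open>g\<close>, applied to both ends of
      an arc.\<close>
    let ?f = "\<lparr>iso_verts = h, iso_arcs = map_prod h h, iso_head = snd, iso_tail = fst\<rparr>"
    have inj_h: "inj_on h V"
      by (auto simp: V_def inj_on_def hg)
    then have "inj_on (map_prod h h) (arcs K)"
      by (auto simp: K_def inj_on_def)
    with wf inj_h show "pre_digraph.digraph_isomorphism K ?f"
      by (auto simp: pre_digraph.digraph_isomorphism_def K_def)
    have "h ` V = pverts H"
      by (auto simp: V_def hg image_image)
    moreover have "map_prod h h ` arcs K = parcs H"
    proof (intro set_eqI iffI)
      fix e assume "e \<in> map_prod h h ` arcs K"
      then obtain i j where "i \<in> pverts H" "j \<in> pverts H" "(g i, g j) \<in> parcs G"
        "e = (h (g i), h (g j))"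
        by (auto simp: K_def V_def)
      then show "e \<in> parcs H"
        by (simp add: hg arcs)
    next
      fix e assume e: "e \<in> parcs H"
      then have *: "fst e \<in> pverts H" "snd e \<in> pverts H"
        using H.arc_fst_in_verts H.arc_snd_in_verts by auto
      then have "(g (fst e), g (snd e)) \<in> arcs K"
        using e arcs[OF *] by (auto simp: K_def V_def)
      then show "e \<in> map_prod h h ` arcs K"
        using * by (auto simp: hg intro!: image_eqI[of _ _ "(g (fst e), g (snd e))"])
    qed
    ultimately show "with_proj H = app_iso ?f K"
      by (simp add: app_iso_def K_def with_proj_def)
  qed
  ultimately show ?thesis
    unfolding contains_induced_def by blast
qed

lemma contains_inducedE:
  assumes "contains_induced G H"
  obtains g where "inj_on g (pverts H)" "g ` pverts H \<subseteq> pverts G"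
    "\<And>i j. \<lbrakk>i \<in> pverts H; j \<in> pverts H\<rbrakk> \<Longrightarrow> (g i, g j) \<in> parcs G \<longleftrightarrow> (i, j) \<in> parcs H"
proof -
  obtain K f where K: "induced_subgraph K (with_proj G)"
    and f: "pre_digraph.digraph_isomorphism K f" and H: "with_proj H = app_iso f K"
    using assms by (auto simp: contains_induced_def digraph_iso_def)
  have sub: "verts K \<subseteq> pverts G" and wf: "wf_digraph K" and ht: "tail K = fst" "head K = snd"
    and arcsK: "arcs K = {e \<in> parcs G. fst e \<in> verts K \<and> snd e \<in> verts K}"
    using K by (auto simp: induced_subgraph_def subgraph_def compatible_def)
  have inj: "inj_on (iso_verts f) (verts K)" 
    and tl: "\<And>a. a \<in> arcs K \<Longrightarrow> iso_tail f (iso_arcs f a) = iso_verts f (fst a)"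
    and hd: "\<And>a. a \<in> arcs K \<Longrightarrow> iso_head f (iso_arcs f a) = iso_verts f (snd a)"
    using f ht by (auto simp: pre_digraph.digraph_isomorphism_def)
  have fH: "pverts H = iso_verts f ` verts K" "parcs H = iso_arcs f ` arcs K"
    "iso_tail f = fst" "iso_head f = snd"
    using arg_cong[OF H, of verts] arg_cong[OF H, of arcs] arg_cong[OF H, of tail] 
      arg_cong[OF H, of head] by auto
  \<comment> \<open>The map on arcs is an independent component of \<open>f\<close>; preservation of
    head and tail forces it to act coordinatewise, since arcs of \<open>H\<close> are pairs.\<close>
  have arcsH: "iso_arcs f a = (iso_verts f (fst a), iso_verts f (snd a))" if "a \<in> arcs K" for a
    using tl[OF that] hd[OF that] by (simp add: fH prod_eq_iff)
  define g where "g = the_inv_into (verts K) (iso_verts f)"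
  have gf: "g (iso_verts f x) = x" if "x \<in> verts K" for x
    using the_inv_into_f_f[OF inj that] by (simp add: g_def)
  show ?thesis
  proof
    show "inj_on g (pverts H)" "g ` pverts H \<subseteq> pverts G"
      using sub by (auto simp: fH gf inj_on_def)
    fix i j assume "i \<in> pverts H" "j \<in> pverts H"
    then obtain x y where xy: "x \<in> verts K" "i = iso_verts f x" "y \<in> verts K" "j = iso_verts f y"
      by (auto simp: fH)
    have "(iso_verts f x, iso_verts f y) \<in> iso_arcs f ` arcs K \<longleftrightarrow> (x, y) \<in> arcs K"
      using inj xy by (force simp: arcsH arcsK inj_on_eq_iff image_iff)
    then show "(g i, g j) \<in> parcs G \<longleftrightarrow> (i, j) \<in> parcs H"
      using xy by (auto simp: fH gf arcsK)
  qed
qed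

section \<open>Distance and adjacency in the square\<close>

lemma
  assumes "pair_wf_digraph G"
  shows graph_dist_le_iff: "graph_dist G u v \<le> ereal (real n) \<longleftrightarrow>
      (\<exists>es. pre_digraph.awalk (with_proj G) u es v \<and> length es \<le> n)" (is ?le)
    and le_graph_dist_iff: "ereal (real n) \<le> graph_dist G u v \<longleftrightarrow>
      (\<forall>es. pre_digraph.awalk (with_proj G) u es v \<longrightarrow> n \<le> length es)" (is ?ge)
proof -
  interpret pair_wf_digraph G by fact
  have cost: "awalk_cost (\<lambda>_. 1) es = real (length es)" for es :: "('a \<times> 'a) list"
    by (induction es) auto
  have dist: "graph_dist G u v = (INF es\<in>{es. awalk u es v}. ereal (real (length es)))"
    by (simp only: graph_dist_def \<mu>_def cost)
  show ?ge
    by (auto simp: dist le_INF_iff)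
  show ?le
  proof
    assume "graph_dist G u v \<le> ereal (real n)"
    \<comment> \<open>A strict bound on the infimum yields a walk. Walk lengths are integers, so
      shorter than \<open>Suc n\<close> is the same as at most \<open>n\<close>.\<close>
    also have "ereal (real n) < ereal (real (Suc n))" by simp
    finally show "\<exists>es. awalk u es v \<and> length es \<le> n"
      by (auto simp: dist INF_less_iff less_Suc_eq_le simp del: of_nat_Suc)
  next
    assume "\<exists>es. awalk u es v \<and> length es \<le> n"
    then show "graph_dist G u v \<le> ereal (real n)"
      by (auto simp: dist intro: INF_lower2)
  qed
qed

lemma graph_square_arcs_iff:
  assumes G: "pair_wf_digraph G" and uv: "u \<in> pverts G" "v \<in> pverts G"
  shows "(u, v) \<in> parcs (graph_square G) \<longleftrightarrow>
    u \<noteq> v \<and> (\<exists>w. (u, w) \<in> (parcs G)\<^sup>= \<and> (w, v) \<in> (parcs G)\<^sup>=)" (is "_ \<longleftrightarrow> u \<noteq> v \<and> ?near")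
proof -
  interpret pair_wf_digraph G by fact
  note le = graph_dist_le_iff[OF G, of u v] and ge = le_graph_dist_iff[OF G, of _ u v]
  have Nil: "awalk u [] v \<longleftrightarrow> u = v"
    using uv by (auto simp: awalk_Nil_iff)
  have le2: "graph_dist G u v \<le> 2 \<longleftrightarrow> ?near"
  proof
    assume "graph_dist G u v \<le> 2"
    then obtain es where es: "awalk u es v" "length es \<le> 2"
      using le[of 2] by auto
    then consider "es = []" | e where "es = [e]" | e e' where "es = [e, e']"
      by (cases es rule: list.exhaust; cases "tl es") (auto simp: Suc_le_eq)
    then show ?near
      using es(1) by cases (auto simp: awalk_simps)
  next
    assume ?near
    then consider "u = v" | "(u, v) \<in> parcs G" | w where "(u, w) \<in> parcs G" "(w, v) \<in> parcs G"
      by auto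
    then have "\<exists>es. awalk u es v \<and> length es \<le> 2"
    proof cases
      case 1
      then show ?thesis using Nil by (intro exI[of _ "[]"]) auto
    next
      case 2
      then show ?thesis using uv by (intro exI[of _ "[(u, v)]"]) (auto simp: awalk_simps)
    next
      case (3 w)
      then show ?thesis
        using uv by (intro exI[of _ "[(u, w), (w, v)]"]) (auto simp: awalk_simps dest: wellformed')
    qed
    then show "graph_dist G u v \<le> 2"
      using le[of 2] by simp
  qed
  have ge1: "1 \<le> graph_dist G u v \<longleftrightarrow> u \<noteq> v"
  proof -
    have "1 \<le> graph_dist G u v \<longleftrightarrow> \<not> awalk u [] v"
      using ge[of 1] by (auto simp: Suc_le_eq one_ereal_def)
    then show ?thesis using Nil by simp
  qed
  \<comment> \<open>Walk lengths are integers, so no distance lies strictly between 1 and 2.\<close>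
  have "graph_dist G u v \<le> 1 \<or> 2 \<le> graph_dist G u v"
    using le[of 1] ge[of 2] by (force simp: one_ereal_def)
  then have "graph_dist G u v \<in> {1, 2} \<longleftrightarrow> 1 \<le> graph_dist G u v \<and> graph_dist G u v \<le> 2"
    by (auto intro: order.trans[of 1 2] order.trans[of _ 1 2])
  then show ?thesis
    using uv le2 ge1 by (simp add: graph_square_def)
qed

section \<open>Closed adjacency with a dominator map\<close>

text \<open>
  \<open>R\<close> is adjacency made reflexive and \<open>p v\<close> the dominator of \<open>v\<close>. Distinct vertices of \<open>P\<^sub>6\<close> and of
  the bull have distinct closed neighbourhoods, so the patterns below force distinctness of their
  vertices, and no equality ever has to be considered.
\<close>

locale bull_P6_free_relation =
  fixes R :: "'a \<Rightarrow> 'a \<Rightarrow> bool" and p :: "'a \<Rightarrow> 'a"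
  assumes refl: "R x x"
    and commute: "R x y \<longleftrightarrow> R y x"
    and dominator: "R v (p u) \<longleftrightarrow> p v = p u"
    and P6: "\<lbrakk>R a b; R b c; R c d; R d e; R e f\<rbrakk> \<Longrightarrow>
      R a c \<or> R a d \<or> R a e \<or> R a f \<or> R b d \<or> R b e \<or> R b f \<or> R c e \<or> R c f \<or> R d f"
    and bull: "\<lbrakk>R a b; R b c; R a c; R a d; R b e\<rbrakk> \<Longrightarrow>
      R d b \<or> R d c \<or> R d e \<or> R e a \<or> R e c"
begin

text \<open>Since \<open>R\<close> is reflexive, \<open>w\<close> may be an endpoint: this is
  distance at most 2.\<close>

definition near :: "'a \<Rightarrow> 'a \<Rightarrow> bool" where
  "near x y \<longleftrightarrow> (\<exists>w. R x w \<and> R w y)"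

section \<open>Forbidden colour patterns\<close>

text \<open>
  The clauses in the following four proofs, a minimal inconsistent set, were found with a SAT solver.
  The witness \<open>wij\<close> is a common neighbour of \<open>vi\<close> and \<open>vj\<close>; \<open>a\<close>, \<open>b\<close>, \<open>c\<close>, \<open>d\<close> are dominators.
\<close>

lemma not_ababc:
  assumes "p v1 \<noteq> p v0" "p v2 = p v0" "p v3 = p v1" "p v4 \<noteq> p v0" "p v4 \<noteq> p v1"
    and far: "\<not> near v0 v1" "\<not> near v1 v2" "\<not> near v2 v3" "\<not> near v3 v4"
    and near: "near v0 v3" "near v1 v4" "near v2 v4"
  shows False
proof -
  obtain w03 w14 w24 where w:
    "R v0 w03" "R w03 v3" "R v1 w14" "R w14 v4" "R v2 w24" "R w24 v4"
    using near by (auto simp: near_def)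
  define a b c where "a = p v0" and "b = p v1" and "c = p v4"
  then have dom: "R v0 a" "R v1 b" "R v2 a" "R v3 b" "R v4 c"
    and excl: "\<not> R x a \<or> \<not> R x b" "\<not> R x a \<or> \<not> R x c" "\<not> R x b \<or> \<not> R x c" for x
    using assms by (auto simp: dominator)
  \<comment> \<open>Consecutive vertices have disjoint closed neighbourhoods. Taking
    \<open>x\<close> to be one of the two shows that they are nonadjacent.\<close>
  have sep: "\<not> R v0 x \<or> \<not> R v1 x" "\<not> R v1 x \<or> \<not> R v2 x" "\<not> R v2 x \<or> \<not> R v3 x" "\<not> R v3 x \<or> \<not> R v4 x" for x
    using far commute by (auto simp: near_def)
  note facts = w dom excl sep refl commute
  \<comment> \<open>Clauses 1 to 4 each read \<open>sep\<close> or \<open>excl\<close> at a shared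
    vertex; here \<open>v0\<close> would be a common neighbour of \<open>v2\<close> and
    \<open>v3\<close>.\<close>
  have 1: "\<not> R v0 v3 \<or> \<not> R v0 v2"
    by (metis excl sep commute)
  have 2: "\<not> R v1 v3 \<or> \<not> R v0 v3"
    by (metis excl sep commute)
  have 3: "\<not> R v1 v4 \<or> \<not> R v1 v3"
    by (metis excl sep commute)
  have 4: "\<not> R w14 b \<or> \<not> R w14 a"
    by (metis excl sep commute)
  \<comment> \<open>Adjacencies \<open>v2 v4\<close> and \<open>w03 a\<close> complete the path
    \<open>v3 w03 a v2 v4 c\<close>, and \<open>excl\<close> and \<open>sep\<close> rule out every
    chord except \<open>w03 c\<close>. The later clauses arise in the same way: what remains are the
    undecided adjacencies.\<close>
  have 5: "\<not> R v2 v4 \<or> \<not> R w03 a \<or> R w03 c"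
    using P6[of v3 w03 a v2 v4 c] facts by metis
  have 6: "\<not> R v2 v4 \<or> R w14 a \<or> \<not> R w14 b"
    using P6[of v3 b w14 v4 v2 a] facts by metis
  have 7: "R v1 v3 \<or> \<not> R w03 a \<or> R w03 b"
    using P6[of v1 b v3 w03 a v2] facts by metis
  \<comment> \<open>Triangle \<open>w14 w24 v4\<close> with \<open>v1\<close> pendant at
    \<open>w14\<close> and \<open>v2\<close> pendant at \<open>w24\<close>.\<close>
  have 8: "R v1 v4 \<or> R v2 v4 \<or> \<not> R w14 w24"
    using bull[of w14 w24 v4 v1 v2] facts by metis
  have 9: "R v0 v2 \<or> \<not> R v0 v3 \<or> R v1 v3"
    using P6[of v1 b v3 v0 a v2] facts by metis
  have 10: "R v0 v2 \<or> R v0 v3 \<or> \<not> R v1 v3 \<or> R w03 a"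
    using P6[of v1 v3 w03 v0 a v2] facts by metis
  have 11: "\<not> R v1 v3 \<or> R v1 v4 \<or> R v2 v4 \<or> R w14 w24"
    using P6[of v2 w24 v4 w14 v1 v3] facts by metis
  have 12: "R v0 v3 \<or> R v1 v3 \<or> \<not> R w03 b"
    using bull[of w03 b v3 v0 v1] facts by metis
  have 13: "R v0 v3 \<or> R v1 v3 \<or> R w03 a \<or> R w03 b"
    using P6[of v1 b v3 w03 v0 a] facts by metis
  have 14: "\<not> R v1 v3 \<or> R v1 v4 \<or> \<not> R v2 v4 \<or> \<not> R w03 c"
    using P6[of v1 v3 w03 c v4 v2] facts by metis
  have 15: "R v0 v3 \<or> \<not> R v0 v4 \<or> \<not> R v1 v3 \<or> R v1 v4 \<or> R w03 c"
    using P6[of v1 v3 w03 v0 v4 c] facts by metis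
  have 16: "\<not> R v0 v2 \<or> R v0 v4 \<or> R v1 v4 \<or> \<not> R v2 v4 \<or> R w14 b"
    using P6[of v0 v2 v4 w14 v1 b] facts by metis
  show False
    using 1 2 3 4 5 6 7 8 9 10 11 12 13 14 15 16 by sat
qed

text \<open>The vertex \<open>v4\<close>, whose colour is left open, contributes the witnesses
  \<open>w14\<close> and \<open>w24\<close> against the pattern \<open>abcd\<close>. All near pairs
  have offset 2 or 3, so length 5 is covered, where offset 4 is again consecutive.\<close>

lemma not_four_consecutive:
  assumes "p v1 \<noteq> p v0" "p v2 \<noteq> p v0" "p v2 \<noteq> p v1" "p v3 \<noteq> p v0" "p v3 \<noteq> p v1" "p v3 \<noteq> p v2"
    and far: "\<not> near v0 v1" "\<not> near v1 v2" "\<not> near v2 v3" "\<not> near v3 v4"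
    and near: "near v0 v2" "near v0 v3" "near v1 v3" "near v1 v4" "near v2 v4"
  shows False
proof -
  obtain w02 w03 w13 w14 w24 where w:
    "R v0 w02" "R w02 v2" "R v0 w03" "R w03 v3" "R v1 w13" "R w13 v3" "R v1 w14" "R w14 v4" "R v2 w24" "R w24 v4"
    using near by (auto simp: near_def)
  define a b c d where "a = p v0" and "b = p v1" and "c = p v2" and "d = p v3"
  then have dom: "R v0 a" "R v1 b" "R v2 c" "R v3 d"
    and excl: "\<not> R x a \<or> \<not> R x b" "\<not> R x a \<or> \<not> R x c" "\<not> R x a \<or> \<not> R x d" "\<not> R x b \<or> \<not> R x c" "\<not> R x b \<or> \<not> R x d" "\<not> R x c \<or> \<not> R x d" for x
    using assms by (auto simp: dominator)
  have sep: "\<not> R v0 x \<or> \<not> R v1 x" "\<not> R v1 x \<or> \<not> R v2 x" "\<not> R v2 x \<or> \<not> R v3 x" "\<not> R v3 x \<or> \<not> R v4 x" for x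
    using far commute by (auto simp: near_def)
  note facts = w dom excl sep refl commute
  have 1: "\<not> R v0 v3 \<or> \<not> R v0 v2"
    by (metis excl sep commute)
  have 2: "\<not> R v0 v4 \<or> \<not> R v0 v3"
    by (metis excl sep commute)
  have 3: "\<not> R v1 v3 \<or> \<not> R v0 v3"
    by (metis excl sep commute)
  have 4: "\<not> R v4 b \<or> \<not> R v4 a"
    by (metis excl sep commute)
  have 5: "\<not> R w02 c \<or> \<not> R w02 a"
    by (metis excl sep commute)
  have 6: "\<not> R w02 d \<or> \<not> R w02 a"
    by (metis excl sep commute)
  have 7: "\<not> R w02 d \<or> \<not> R w02 b"
    by (metis excl sep commute)
  have 8: "\<not> R w02 d \<or> \<not> R w02 c"
    by (metis excl sep commute)
  have 9: "\<not> R w03 c \<or> \<not> R w03 a"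
    by (metis excl sep commute)
  have 10: "\<not> R w03 d \<or> \<not> R w03 a"
    by (metis excl sep commute)
  have 11: "\<not> R w03 c \<or> \<not> R w03 b"
    by (metis excl sep commute)
  have 12: "\<not> R w13 b \<or> \<not> R w13 a"
    by (metis excl sep commute)
  have 13: "\<not> R w13 c \<or> \<not> R w13 a"
    by (metis excl sep commute)
  have 14: "\<not> R w13 d \<or> \<not> R w13 a"
    by (metis excl sep commute)
  have 15: "\<not> R w14 d \<or> \<not> R w14 a"
    by (metis excl sep commute)
  have 16: "\<not> R w14 d \<or> \<not> R w14 b"
    by (metis excl sep commute)
  have 17: "\<not> R w24 d \<or> \<not> R w24 a"
    by (metis excl sep commute)
  have 18: "\<not> R w24 d \<or> \<not> R w24 b"
    by (metis excl sep commute)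
  have 19: "\<not> R w24 d \<or> \<not> R w24 c"
    by (metis excl sep commute)
  have 20: "\<not> R v1 v3 \<or> R w03 b \<or> \<not> R w03 c"
    using P6[of v2 c w03 v3 v1 b] facts by metis
  have 21: "R v0 v3 \<or> R v1 v3 \<or> \<not> R w03 w13"
    using bull[of w03 w13 v3 v0 v1] facts by metis
  have 22: "\<not> R v0 v2 \<or> R v0 v3 \<or> \<not> R w13 a \<or> R w13 d"
    using P6[of v2 v0 a w13 v3 d] facts by metis
  have 23: "R v0 v3 \<or> R w02 w03 \<or> R w02 a \<or> \<not> R w03 a"
    using bull[of v0 w03 a w02 v3] facts by metis
  have 24: "\<not> R v0 v3 \<or> R v1 v3 \<or> \<not> R w14 a \<or> R w14 d"
    using P6[of v1 w14 a v0 v3 d] facts by metis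
  have 25: "R v0 v2 \<or> R w02 w13 \<or> R w02 a \<or> \<not> R w13 a"
    using P6[of v1 w13 a v0 w02 v2] facts by metis
  have 26: "\<not> R v0 v2 \<or> R v0 v3 \<or> R w13 a \<or> \<not> R w13 c"
    using P6[of v3 w13 c v2 v0 a] facts by metis
  have 27: "R w13 w24 \<or> \<not> R w13 a \<or> R w13 d \<or> R w24 a \<or> \<not> R w24 d"
    using P6[of v2 w24 d v3 w13 a] facts by metis
  have 28: "\<not> R v0 v3 \<or> R v0 v4 \<or> R v1 v3 \<or> R v1 v4 \<or> R w13 w14"
    using P6[of v0 v3 w13 v1 w14 v4] facts by metis
  have 29: "R w03 w13 \<or> R w03 a \<or> \<not> R w03 d \<or> \<not> R w13 a \<or> R w13 d"
    using P6[of v1 w13 a v0 w03 d] facts by metis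
  have 30: "R v0 v2 \<or> \<not> R v0 v3 \<or> R w02 w13 \<or> R w02 c \<or> R w13 c"
    using P6[of w13 v3 v0 w02 v2 c] facts by metis
  have 31: "\<not> R w13 w24 \<or> R w13 b \<or> R w13 c \<or> R w24 b \<or> R w24 c"
    using P6[of b v1 w13 w24 v2 c] facts by metis
  have 32: "R v0 v3 \<or> R v1 v3 \<or> R w03 w13 \<or> R w03 a \<or> R w13 a"
    using P6[of v1 w13 v3 w03 v0 a] facts by metis
  have 33: "R v0 w24 \<or> \<not> R w02 w13 \<or> \<not> R w02 w24 \<or> \<not> R w13 w24"
    using bull[of w02 w13 w24 v0 v1] facts by metis
  have 34: "R v0 v2 \<or> R v0 v3 \<or> R w02 w03 \<or> R w02 d \<or> R w03 d"
    using P6[of v2 w02 v0 w03 v3 d] facts by metis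
  have 35: "R v1 v3 \<or> \<not> R w13 w14 \<or> R w13 b \<or> R w14 b"
    using bull[of v1 w13 w14 b v3] facts by metis
  have 36: "R v0 v2 \<or> R v0 v3 \<or> \<not> R w02 w03"
    using bull[of w02 w03 v0 v2 v3] facts by metis
  have 37: "R v1 v3 \<or> R v1 v4 \<or> \<not> R w13 w14"
    using bull[of w13 w14 v1 v3 v4] facts by metis
  have 38: "R v0 v2 \<or> R v0 v3 \<or> \<not> R v1 v3 \<or> R w02 w03"
    using P6[of v1 v3 w03 v0 w02 v2] facts by metis
  have 39: "R v1 v3 \<or> \<not> R v1 v4 \<or> R w13 w24 \<or> R w13 d \<or> R w24 d"
    using P6[of w24 v4 v1 w13 v3 d] facts by metis
  have 40: "\<not> R v0 v3 \<or> R v0 v4 \<or> \<not> R v4 a \<or> R w14 a \<or> R w14 d"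
    using P6[of w14 v4 a v0 v3 d] facts by metis
  have 41: "\<not> R w02 w13 \<or> R w02 b \<or> R w02 c \<or> R w13 b \<or> R w13 c"
    using P6[of b v1 w13 w02 v2 c] facts by metis
  have 42: "R v1 v3 \<or> \<not> R v1 v4 \<or> R v4 b \<or> \<not> R w13 b"
    using bull[of v1 w13 b v4 v3] facts by metis
  have 43: "\<not> R v0 v2 \<or> \<not> R w03 w13 \<or> R w03 c \<or> R w13 c"
    using P6[of v1 w13 w03 v0 v2 c] facts by metis
  have 44: "\<not> R v0 v3 \<or> R v1 v3 \<or> R w13 w14 \<or> R w13 a \<or> R w14 a"
    using P6[of w14 v1 w13 v3 v0 a] facts by metis
  have 45: "R v0 v2 \<or> \<not> R v0 v3 \<or> R v0 w24 \<or> R w02 w24 \<or> R w02 d \<or> R w24 d"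
    using P6[of w24 v2 w02 v0 v3 d] facts by metis
  have 46: "\<not> R v0 v3 \<or> R v0 v4 \<or> \<not> R v0 w24 \<or> R v1 v3 \<or> \<not> R v1 v4 \<or> R w24 d"
    using P6[of v1 v4 w24 v0 v3 d] facts by metis
  have 47: "\<not> R v0 v2 \<or> R v0 v3 \<or> R w03 w13 \<or> R w03 c \<or> R w13 c"
    using P6[of w13 v3 w03 v0 v2 c] facts by metis
  have 48: "\<not> R v0 v3 \<or> R v0 v4 \<or> R v4 a \<or> \<not> R w13 w14 \<or> R w13 a \<or> R w14 a"
    using P6[of v4 w14 w13 v3 v0 a] facts by metis
  show False
    using 1 2 3 4 5 6 7 8 9 10 11 12 13 14 15 16 17 18 19 20 21 22 23 24 25 26 27 28 29 30 31 32 33 34 35 36 37 38 39 40 41 42 43 44 45 46 47 48 by sat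
qed

text \<open>The pattern \<open>abcb\<close> sits on \<open>v1\<close> to \<open>v4\<close>;
  \<open>v0\<close> and \<open>v5\<close>, of any colour, continue it on both sides. The pair
  \<open>v0\<close>, \<open>v5\<close> has offset 5, which in an odd antihole is nonconsecutive only
  from length 7 on.\<close>

lemma not_reflected_colours:
  assumes "p v2 \<noteq> p v1" "p v3 \<noteq> p v1" "p v3 \<noteq> p v2" "p v4 = p v2"
    and far: "\<not> near v0 v1" "\<not> near v1 v2" "\<not> near v2 v3" "\<not> near v3 v4" "\<not> near v4 v5"
    and near: "near v0 v3" "near v0 v5" "near v1 v4" "near v1 v5" "near v2 v5" "near v3 v5"
  shows False
proof -
  obtain w03 w05 w14 w15 w25 w35 where w:
    "R v0 w03" "R w03 v3" "R v0 w05" "R w05 v5" "R v1 w14" "R w14 v4" "R v1 w15" "R w15 v5" "R v2 w25" "R w25 v5" "R v3 w35" "R w35 v5"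
    using near by (auto simp: near_def)
  \<comment> \<open>The dominator \<open>b\<close> doubles as a common neighbour of
    \<open>v2\<close> and \<open>v4\<close>.\<close>
  define a b c where "a = p v1" and "b = p v2" and "c = p v3"
  then have dom: "R v1 a" "R v2 b" "R v3 c" "R v4 b"
    and excl: "\<not> R x a \<or> \<not> R x b" "\<not> R x a \<or> \<not> R x c" "\<not> R x b \<or> \<not> R x c" for x
    using assms by (auto simp: dominator)
  have sep: "\<not> R v0 x \<or> \<not> R v1 x" "\<not> R v1 x \<or> \<not> R v2 x" "\<not> R v2 x \<or> \<not> R v3 x" "\<not> R v3 x \<or> \<not> R v4 x" "\<not> R v4 x \<or> \<not> R v5 x" for x
    using far commute by (auto simp: near_def)
  note facts = w dom excl sep refl commute
  have 1: "\<not> R v1 v4 \<or> \<not> R v0 v4"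
    by (metis excl sep commute)
  have 2: "\<not> R v1 v4 \<or> \<not> R v1 v3"
    by (metis excl sep commute)
  have 3: "\<not> R v1 v5 \<or> \<not> R v1 v4"
    by (metis excl sep commute)
  have 4: "\<not> R v2 v4 \<or> \<not> R v1 v4"
    by (metis excl sep commute)
  have 5: "\<not> R v2 v5 \<or> \<not> R v1 v5"
    by (metis excl sep commute)
  have 6: "\<not> R v2 v5 \<or> \<not> R v2 v4"
    by (metis excl sep commute)
  have 7: "\<not> R v5 c \<or> \<not> R v5 a"
    by (metis excl sep commute)
  have 8: "\<not> R w03 b \<or> \<not> R w03 a"
    by (metis excl sep commute)
  have 9: "\<not> R w05 c \<or> \<not> R w05 a"
    by (metis excl sep commute)
  have 10: "\<not> R w14 b \<or> \<not> R w14 a"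
    by (metis excl sep commute)
  have 11: "\<not> R w14 c \<or> \<not> R w14 a"
    by (metis excl sep commute)
  have 12: "\<not> R w14 c \<or> \<not> R w14 b"
    by (metis excl sep commute)
  have 13: "\<not> R w15 b \<or> \<not> R w15 a"
    by (metis excl sep commute)
  have 14: "\<not> R w25 b \<or> \<not> R w25 a"
    by (metis excl sep commute)
  have 15: "\<not> R w25 c \<or> \<not> R w25 a"
    by (metis excl sep commute)
  have 16: "\<not> R w25 c \<or> \<not> R w25 b"
    by (metis excl sep commute)
  have 17: "R v2 v5 \<or> R v3 v5 \<or> \<not> R w25 w35"
    using bull[of w25 w35 v5 v2 v3] facts by metis
  have 18: "R v2 v4 \<or> R v2 v5 \<or> \<not> R w25 b"
    using bull[of w25 b v2 v5 v4] facts by metis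
  have 19: "R v1 v4 \<or> R v2 v4 \<or> \<not> R w14 b"
    using bull[of w14 b v4 v1 v2] facts by metis
  have 20: "R v0 v5 \<or> R v1 v5 \<or> \<not> R w05 w15"
    using bull[of w05 w15 v5 v0 v1] facts by metis
  have 21: "R v1 v3 \<or> \<not> R v1 v4 \<or> R w03 a \<or> \<not> R w03 b"
    using P6[of v3 w03 b v4 v1 a] facts by metis
  have 22: "R v1 v4 \<or> R v2 v4 \<or> \<not> R w25 a \<or> R w25 b"
    using P6[of v1 a w25 v2 b v4] facts by metis
  have 23: "\<not> R v2 v4 \<or> R v2 v5 \<or> R v3 v5 \<or> R w25 w35"
    using P6[of v3 w35 v5 w25 v2 v4] facts by metis
  have 24: "\<not> R v3 v5 \<or> \<not> R w14 w25 \<or> R w14 b \<or> R w25 b"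
    using P6[of v3 v5 w25 w14 v4 b] facts by metis
  have 25: "\<not> R v1 v4 \<or> R v2 v4 \<or> R w25 a \<or> R w25 b"
    using P6[of w25 v2 b v4 v1 a] facts by metis
  have 26: "R v1 v5 \<or> R v2 v5 \<or> \<not> R w15 w25"
    using bull[of w15 w25 v5 v1 v2] facts by metis
  have 27: "\<not> R v2 v4 \<or> R v2 v5 \<or> \<not> R v3 v5 \<or> R w14 w25"
    using P6[of v3 v5 w25 v2 v4 w14] facts by metis
  have 28: "\<not> R v1 v3 \<or> \<not> R w14 b \<or> R w14 c"
    using P6[of v2 b w14 v1 v3 c] facts by metis
  have 29: "\<not> R v1 v4 \<or> R v2 v4 \<or> \<not> R w03 a \<or> R w03 b"
    using P6[of v2 b v4 v1 a w03] facts by metis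
  have 30: "R v1 v4 \<or> \<not> R v1 v5 \<or> R v2 v4 \<or> R v2 v5 \<or> R w25 b"
    using P6[of v1 v5 w25 v2 b v4] facts by metis
  have 31: "R v1 v4 \<or> R v1 v5 \<or> \<not> R w14 w15"
    using bull[of w14 w15 v1 v4 v5] facts by metis
  have 32: "R v0 v4 \<or> R v0 v5 \<or> \<not> R v1 v4 \<or> R v1 v5 \<or> R w05 w15"
    using P6[of v0 w05 v5 w15 v1 v4] facts by metis
  have 33: "\<not> R v1 v4 \<or> R v1 v5 \<or> R v5 a \<or> \<not> R w25 a \<or> R w25 b"
    using P6[of v5 w25 a v1 v4 b] facts by metis
  have 34: "R v1 v3 \<or> \<not> R v1 v5 \<or> \<not> R v3 v5 \<or> \<not> R v5 a \<or> R w14 a"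
    using bull[of v1 v5 a w14 v3] facts by metis
  have 35: "R v1 v4 \<or> \<not> R v1 v5 \<or> R v5 a \<or> R w25 a \<or> \<not> R w25 b"
    using P6[of v4 b w25 v5 v1 a] facts by metis
  have 36: "\<not> R v1 v4 \<or> R v1 v5 \<or> \<not> R v5 a \<or> R w05 a \<or> R w05 b"
    using P6[of w05 v5 a v1 v4 b] facts by metis
  have 37: "\<not> R v3 v5 \<or> R v5 c \<or> \<not> R w14 w25 \<or> R w14 c \<or> R w25 c"
    using P6[of v4 w14 w25 v5 v3 c] facts by metis
  have 38: "R v1 v4 \<or> R v1 v5 \<or> \<not> R v2 v4 \<or> R v2 v5 \<or> R w14 w15"
    using P6[of v2 v4 w14 v1 w15 v5] facts by metis
  have 39: "R v0 v4 \<or> \<not> R v1 v4 \<or> R w03 w05 \<or> R w03 a \<or> \<not> R w05 a"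
    using P6[of v4 v1 a w05 v0 w03] facts by metis
  have 40: "R v1 v4 \<or> R v1 v5 \<or> R v2 v4 \<or> \<not> R v2 v5 \<or> R w14 b"
    using P6[of v1 w14 v4 b v2 v5] facts by metis
  have 41: "\<not> R v3 v5 \<or> \<not> R v5 a \<or> R v5 c \<or> R w14 a \<or> \<not> R w14 c"
    using P6[of v4 w14 c v3 v5 a] facts by metis
  have 42: "\<not> R v1 v5 \<or> R v2 v5 \<or> \<not> R v5 c \<or> \<not> R w14 b \<or> R w14 c"
    using P6[of v2 b w14 v1 v5 c] facts by metis
  have 43: "R v1 v3 \<or> \<not> R v1 v4 \<or> \<not> R v3 w05 \<or> \<not> R w05 a \<or> R w05 c"
    using P6[of v4 v1 a w05 v3 c] facts by metis
  have 44: "R w15 w25 \<or> R w15 a \<or> \<not> R w15 b \<or> R w25 a \<or> R w25 b"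
    using P6[of w25 v2 b w15 v1 a] facts by metis
  have 45: "R v1 v4 \<or> R v2 v4 \<or> R w14 w15 \<or> R w14 b \<or> R w15 b"
    using P6[of v2 b v4 w14 v1 w15] facts by metis
  have 46: "\<not> R v1 v5 \<or> R v2 v5 \<or> R v5 a \<or> R w25 a \<or> R w25 b"
    using P6[of a v1 v5 w25 v2 b] facts by metis
  have 47: "\<not> R v1 v4 \<or> R v1 v5 \<or> R v5 a \<or> R w25 a \<or> \<not> R w25 b"
    using P6[of v5 w25 b v4 v1 a] facts by metis
  have 48: "\<not> R v0 v5 \<or> R v0 b \<or> \<not> R v5 a \<or> R w05 a \<or> \<not> R w05 b"
    using bull[of v5 w05 v0 a b] facts by metis
  have 49: "R v0 v4 \<or> \<not> R v0 b \<or> \<not> R v1 v4 \<or> R w03 a \<or> R w03 b"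
    using P6[of w03 v0 b v4 v1 a] facts by metis
  have 50: "R v1 v3 \<or> \<not> R v1 v4 \<or> R v3 w05 \<or> \<not> R w03 w05 \<or> R w03 a \<or> \<not> R w05 a"
    using P6[of v3 w03 w05 a v1 v4] facts by metis
  show False
    using 1 2 3 4 5 6 7 8 9 10 11 12 13 14 15 16 17 18 19 20 21 22 23 24 25 26 27 28 29 30 31 32 33 34 35 36 37 38 39 40 41 42 43 44 45 46 47 48 49 50 by sat
qed

text \<open>Vertices at offset 3 already have their dominator as a common neighbour; the assumed
  near pairs have offsets 2, 4 and 5. Hence length 7 is covered, where \<open>v0\<close> and
  \<open>v6\<close> are consecutive.\<close>

lemma not_period_three:
  assumes "p v1 \<noteq> p v0" "p v2 \<noteq> p v0" "p v2 \<noteq> p v1" "p v3 = p v0" "p v4 = p v1" "p v5 = p v2" "p v6 = p v0"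
    and far: "\<not> near v0 v1" "\<not> near v1 v2" "\<not> near v2 v3" "\<not> near v3 v4" "\<not> near v4 v5" "\<not> near v5 v6"
    and near: "near v0 v5" "near v1 v5" "near v1 v6" "near v3 v5"
  shows False
proof -
  obtain w05 w15 w16 w35 where w:
    "R v0 w05" "R w05 v5" "R v1 w15" "R w15 v5" "R v1 w16" "R w16 v6" "R v3 w35" "R w35 v5"
    using near by (auto simp: near_def)
  define a b c where "a = p v0" and "b = p v1" and "c = p v2"
  then have dom: "R v0 a" "R v1 b" "R v2 c" "R v3 a" "R v4 b" "R v5 c" "R v6 a"
    and excl: "\<not> R x a \<or> \<not> R x b" "\<not> R x a \<or> \<not> R x c" "\<not> R x b \<or> \<not> R x c" for x
    using assms by (auto simp: dominator)
  have sep: "\<not> R v0 x \<or> \<not> R v1 x" "\<not> R v1 x \<or> \<not> R v2 x" "\<not> R v2 x \<or> \<not> R v3 x" "\<not> R v3 x \<or> \<not> R v4 x" "\<not> R v4 x \<or> \<not> R v5 x" "\<not> R v5 x \<or> \<not> R v6 x" for x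
    using far commute by (auto simp: near_def)
  note facts = w dom excl sep refl commute
  have 1: "\<not> R v1 v4 \<or> \<not> R v0 v4"
    by (metis excl sep commute)
  have 2: "\<not> R v0 v6 \<or> \<not> R v0 v5"
    by (metis excl sep commute)
  have 3: "\<not> R v1 v5 \<or> \<not> R v1 v4"
    by (metis excl sep commute)
  have 4: "\<not> R v2 v5 \<or> \<not> R v1 v5"
    by (metis excl sep commute)
  have 5: "\<not> R v2 v5 \<or> \<not> R v2 v4"
    by (metis excl sep commute)
  have 6: "\<not> R w35 c \<or> \<not> R w35 b"
    by (metis excl sep commute)
  have 7: "\<not> R v2 v4 \<or> R w35 b \<or> \<not> R w35 c"
    using P6[of v3 w35 c v2 v4 b] facts by metis
  have 8: "R v0 v5 \<or> R v1 v5 \<or> \<not> R w05 w15"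
    using bull[of w05 w15 v5 v0 v1] facts by metis
  have 9: "R v1 v4 \<or> R v1 v5 \<or> \<not> R w15 b"
    using bull[of w15 b v1 v5 v4] facts by metis
  have 10: "R v1 v5 \<or> R v1 v6 \<or> \<not> R w15 w16"
    using bull[of w15 w16 v1 v5 v6] facts by metis
  have 11: "\<not> R v2 v4 \<or> R v2 v5 \<or> \<not> R v3 v5"
    using P6[of v3 v5 c v2 v4 b] facts by metis
  have 12: "\<not> R v2 v4 \<or> R v2 v5 \<or> R v3 v5 \<or> R w35 c"
    using P6[of v3 w35 v5 c v2 v4] facts by metis
  have 13: "\<not> R v0 v5 \<or> R v0 v6 \<or> R v1 v5 \<or> \<not> R v1 v6"
    using P6[of v1 v6 a v0 v5 c] facts by metis
  have 14: "R v1 v4 \<or> R v2 v4 \<or> R w15 b \<or> \<not> R w15 c"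
    using P6[of v2 c w15 v1 b v4] facts by metis
  have 15: "\<not> R v0 v5 \<or> R v0 v6 \<or> R v1 v5 \<or> R v1 v6 \<or> R w15 w16"
    using P6[of v0 v5 w15 v1 w16 v6] facts by metis
  have 16: "R v1 v4 \<or> R v1 v5 \<or> R w15 b \<or> R w15 c"
    using P6[of v4 b v1 w15 v5 c] facts by metis
  have 17: "R v0 v4 \<or> R v0 v5 \<or> \<not> R v1 v4 \<or> R v1 v5 \<or> R w05 w15"
    using P6[of v0 w05 v5 w15 v1 v4] facts by metis
  have 18: "R v1 v4 \<or> \<not> R v1 v5 \<or> R v2 v4 \<or> R v2 v5"
    using P6[of v2 c v5 v1 b v4] facts by metis
  show False
    using 1 2 3 4 5 6 7 8 9 10 11 12 13 14 15 16 17 18 by sat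
qed

section \<open>Combining the patterns around the antihole\<close>

text \<open>The antihole is unrolled into a sequence of period \<open>n\<close>, which avoids
  modular indices; offsets from 2 to \<open>n - 2\<close> are exactly the nonconsecutive
  ones.\<close>

lemma no_odd_antihole:
  fixes v :: "nat \<Rightarrow> 'a"
  assumes "odd n" "n \<ge> 5"
    and periodic: "\<And>i. v (i + n) = v i"
    and far: "\<And>i. \<not> near (v i) (v (Suc i))"
    and near: "\<And>i k. \<lbrakk>2 \<le> k; k + 2 \<le> n\<rbrakk> \<Longrightarrow> near (v i) (v (i + k))"
  shows False
proof -
  \<comment> \<open>A shared dominator would be a common neighbour.\<close>
  have neq: "p (v i) \<noteq> p (v (i + 1))" for i
    using far[of i] dominator[of "v i" "v i"] dominator[of "v (Suc i)" "v i"] commute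
    by (auto simp: near_def)
  note not_near = far[unfolded Suc_eq_plus1]
  have four: "p (v (i + 2)) = p (v i) \<or> p (v (i + 3)) = p (v i) \<or> p (v (i + 3)) = p (v (i + 1))" for i
    \<comment> \<open>Arguments follow the first occurrence of the variables in the lemma, hence
      \<open>v1\<close> before \<open>v0\<close>.\<close>
    using not_four_consecutive[of "v (i + 1)" "v i" "v (i + 2)" "v (i + 3)" "v (i + 4)"]
      neq[of i] neq[of "i + 1"] neq[of "i + 2"] \<open>n \<ge> 5\<close>
      not_near[of i] not_near[of "i + 1"] not_near[of "i + 2"] not_near[of "i + 3"]
      near[of 2 i] near[of 3 i] near[of 2 "i + 1"] near[of 3 "i + 1"] near[of 2 "i + 2"]
    by (auto simp add: numeral_eq_Suc)
  have "n \<noteq> 6"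
    using \<open>odd n\<close> by auto
  then consider "n = 5" | "n \<ge> 7"
    using \<open>n \<ge> 5\<close> by atomize_elim linarith
  then show False
  proof cases
    case 1
    \<comment> \<open>After \<open>abab\<close>, the fifth vertex is consecutive to both the fourth
      and, by periodicity, the first. So its colour is a third one.\<close>
    have ababc: "p (v (i + 2)) \<noteq> p (v i) \<or> p (v (i + 3)) \<noteq> p (v (i + 1))" for i
      using not_ababc[of "v (i + 1)" "v i" "v (i + 2)" "v (i + 3)" "v (i + 4)"]
        neq[of i] neq[of "i + 1"] neq[of "i + 3"] neq[of "i + 4"] periodic[of i]
        not_near[of i] not_near[of "i + 1"] not_near[of "i + 2"] not_near[of "i + 3"]
        near[of 3 i] near[of 3 "i + 1"] near[of 2 "i + 2"] 1
      by (auto simp add: numeral_eq_Suc)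
    have v: "v 5 = v 0" "v 6 = v 1" "v 7 = v 2"
      using periodic[of 0] periodic[of 1] periodic[of 2] 1 by simp_all
    show False
      \<comment> \<open>At most one of the five cyclic pairs at offset 2 is monochromatic: two such
        pairs with starting points one apart give \<open>ababc\<close>, with starting points two
        apart they equate consecutive colours. Each instance of \<open>four\<close> mentions three
        of the five pairs, so some instance misses the exceptional one.\<close>
      using four[of 0] four[of 1] four[of 2] four[of 3] four[of 4]
        ababc[of 0] ababc[of 1] ababc[of 2] ababc[of 3] ababc[of 4]
        neq[of 0] neq[of 1] neq[of 2] neq[of 3] neq[of 4]
      by (simp add: v del: One_nat_def add_2_eq_Suc add_2_eq_Suc') argo
  next
    case 2
    \<comment> \<open>Repetition at offset 2 spreads backwards; contrapositively, a failure to
      repeat spreads forwards.\<close>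
    have reflect: "p (v (i + 1)) = p (v (i + 3))" if "p (v (i + 2)) = p (v (i + 4))" for i
    proof (rule ccontr)
      assume "p (v (i + 1)) \<noteq> p (v (i + 3))"
      then show False
        using not_reflected_colours[of "v (i + 2)" "v (i + 1)" "v (i + 3)" "v (i + 4)" "v i" "v (i + 5)"]
          that[symmetric] neq[of "i + 1"] neq[of "i + 2"]
          not_near[of i] not_near[of "i + 1"] not_near[of "i + 2"] not_near[of "i + 3"] not_near[of "i + 4"]
          near[of 3 i] near[of 5 i] near[of 3 "i + 1"] near[of 4 "i + 1"]
          near[of 3 "i + 2"] near[of 2 "i + 3"] 2
        by (simp add: eval_nat_numeral)
    qed
    show False
    proof (cases "\<forall>i. p (v (i + 2)) = p (v i)")
      case True
      \<comment> \<open>All even positions share a colour, and the even position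
        \<open>n + 1\<close> is position 1.\<close>
      have "p (v (2 * m)) = p (v 0)" for m
        by (induction m) (use True in \<open>auto simp: numeral_eq_Suc\<close>)
      then have "p (v (n + 1)) = p (v 0)"
        using \<open>odd n\<close> by (metis odd_one odd_even_add dvdE)
      then show False
        using neq[of 0] periodic[of 1] by (simp add: add.commute)
    next
      case False
      then obtain i where i: "p (v (i + 2)) \<noteq> p (v i)" by blast
      have shift: "v (j + n * k) = v j" for j k
      proof (induction k)
        case (Suc k)
        then show ?case
          using periodic[of "j + n * k"] by (simp add: algebra_simps)
      qed simp
      \<comment> \<open>Starting one period later keeps the index \<open>i + n + m - 1\<close> below
        free of truncated subtraction.\<close>
      have "p (v (i + n + m + 2)) \<noteq> p (v (i + n + m))" for m
      proof (induction m)
        case 0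
        then show ?case
          using i periodic[of i] periodic[of "i + 2"] by (simp add: algebra_simps)
      next
        case (Suc m)
        then show ?case
          using reflect[of "i + n + m - 1"] 2 by (auto simp: numeral_eq_Suc)
      qed
      then have no_repeat: "p (v (l + 2)) \<noteq> p (v l)" if "i + n \<le> l" for l
        using that by (metis le_iff_add)
      \<comment> \<open>Moving \<open>j\<close> forward by \<open>Suc i\<close> periods takes it
        past \<open>i + n\<close> without changing the vertex.\<close>
      have distinct: "p (v (j + 2)) \<noteq> p (v j)" for j
      proof -
        have "i \<le> n * i"
          using 2 by simp
        then have "i + n \<le> j + n * Suc i"
          unfolding mult_Suc_right by linarith
        moreover have "v (j + n * Suc i + 2) = v (j + 2)"
          using shift[of "j + 2" "Suc i"] by (simp only: ac_simps)
        ultimately show ?thesis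
          using no_repeat[of "j + n * Suc i"] shift[of j "Suc i"] by simp
      qed
      \<comment> \<open>Of the three alternatives in \<open>four\<close>, the two repetitions at
        offset 2 are excluded by \<open>distinct\<close>.\<close>
      have period: "p (v (j + 3)) = p (v j)" for j
        using four[of j] neq[of j] distinct[of j] distinct[of "j + 1"]
        by (auto simp: numeral_eq_Suc)
      show False
        using not_period_three[of "v 1" "v 0" "v 2" "v 3" "v 4" "v 5" "v 6"]
          neq[of 0] neq[of 1] distinct[of 0]
          period[of 0] period[of 1] period[of 2] period[of 3]
          not_near[of 0] not_near[of 1] not_near[of 2] not_near[of 3] not_near[of 4] not_near[of 5]
          near[of 5 0] near[of 4 1] near[of 5 1] near[of 2 3] 2
        by (simp del: One_nat_def add_2_eq_Suc add_2_eq_Suc')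
    qed
  qed
qed

end

section \<open>Graphs as instances of the abstract relation\<close>

lemma pair_wf_digraph_path_graph: "pair_wf_digraph (path_graph k)"
  by unfold_locales (auto simp: path_graph_def)

lemma pverts_bull_graph: "pverts bull_graph = {0, 1, 2, 3, 4}"
  and parcs_bull_graph: "parcs bull_graph =
    {(0, 1), (1, 2), (0, 2), (0, 3), (1, 4), (1, 0), (2, 1), (2, 0), (3, 0), (4, 1)}"
  by (auto simp: bull_graph_def)

lemma pair_wf_digraph_bull_graph: "pair_wf_digraph bull_graph"
  by unfold_locales (auto simp: pverts_bull_graph parcs_bull_graph)

text \<open>The locale speaks about the whole type, so \<open>p\<close> is the identity off the
  graph; there \<open>R\<close> is equality and the dominator law still holds.\<close>

lemma bull_P6_free_relation:
  assumes "pair_graph G" and free: "P6_bull_free G" and D: "efficient_dominating_set G D"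
  defines "R \<equiv> \<lambda>u v. (u, v) \<in> (parcs G)\<^sup>="
    and "p \<equiv> \<lambda>v. if v \<in> pverts G then THE d. d \<in> D \<and> vert_dominates G d v else v"
  shows "bull_P6_free_relation R p"
proof -
  interpret pair_graph G by fact
  have sym: "(u, v) \<in> parcs G \<longleftrightarrow> (v, u) \<in> parcs G" for u v
    using pair_sym_arcs by (auto simp: symmetric_def sym_def)
  have refl: "R u u" for u
    by (simp add: R_def)
  have commute: "R u v \<longleftrightarrow> R v u" for u v
    using sym[of u v] by (auto simp: R_def)
  have symD: "R v u" if "R u v" for u v
    using that commute by blast
  have not_symD: "\<not> R v u" if "\<not> R u v" for u v
    using that commute by blast
  have unique: "\<exists>!d. d \<in> D \<and> vert_dominates G d v" if "v \<in> pverts G" for v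
    using D that by (auto simp: efficient_dominating_set_def)
  have p: "p v = d \<longleftrightarrow> d \<in> D \<and> R v d" if "v \<in> pverts G" for v d
    using theI'[OF unique[OF that]] unique[OF that] that sym[of d v]
    by (auto simp: p_def R_def vert_dominates_def)
  have R_in: "u \<in> pverts G \<longleftrightarrow> v \<in> pverts G" if "R u v" for u v
    using that wellformed' by (auto simp: R_def)
  have p_in: "p v \<in> pverts G \<longleftrightarrow> v \<in> pverts G" for v
    using D p[of v "p v"] by (auto simp: p_def efficient_dominating_set_def)
  \<comment> \<open>A list that matched \<open>H\<close> at all pairs of positions would be an
    induced copy. Only \<open>i \<noteq> j\<close> is compared, as \<open>R\<close> is reflexive
    while \<open>H\<close> has no loops.\<close>
  have no_induced: "\<exists>i \<in> pverts H. \<exists>j \<in> pverts H. i \<noteq> j \<and> (R (xs ! i) (xs ! j) \<noteq> ((i, j) \<in> parcs H))"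
    if "\<not> contains_induced G H" "pair_wf_digraph H" "pverts H = {..<length xs}" 
      "distinct xs" "set xs \<subseteq> pverts G" "\<forall>i. (i, i) \<notin> parcs H" for xs and H :: "nat pair_pre_digraph"
  proof (rule ccontr)
    assume *: "\<not> ?thesis"
    have "contains_induced G H"
    proof (rule contains_inducedI)
      show "inj_on ((!) xs) (pverts H)"
        using that by (simp add: inj_on_nth)
      show "(!) xs ` pverts H \<subseteq> pverts G"
        using that by (auto dest: nth_mem)
      fix i j assume "i \<in> pverts H" "j \<in> pverts H"
      then show "(xs ! i, xs ! j) \<in> parcs G \<longleftrightarrow> (i, j) \<in> parcs H"
        using * that pair_no_loops[of "(xs ! i, xs ! i)"] by (cases "i = j") (auto simp: R_def nth_eq_iff_index_eq)
    qed (use that pair_wf_digraph_axioms in auto)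
    with that show False by blast
  qed
  show ?thesis
  proof
    show "R x x" for x by (fact refl)
    show "R x y \<longleftrightarrow> R y x" for x y by (fact commute)
    show "R v (p u) \<longleftrightarrow> p v = p u" for u v
    proof (cases "v \<in> pverts G \<and> u \<in> pverts G")
      case True
      then show ?thesis using p by metis
    next
      case False
      then consider "(v \<in> pverts G) \<noteq> (u \<in> pverts G)" | "v \<notin> pverts G" "u \<notin> pverts G"
        by blast
      then show ?thesis
      proof cases
        \<comment> \<open>Both sides are false: neither \<open>R\<close> nor \<open>p\<close>
          crosses the boundary of the vertex set.\<close>
        case 1
        then show ?thesis
          using R_in[of v "p u"] p_in[of u] p_in[of v] by metis
      next
        case 2
        then show ?thesis
          by (auto simp: p_def R_def dest: wellformed')
      qed
    qed
  next
    fix a b c d e f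
    assume pos: "R a b" "R b c" "R c d" "R d e" "R e f"
    show "R a c \<or> R a d \<or> R a e \<or> R a f \<or> R b d \<or> R b e \<or> R b f \<or> R c e \<or> R c f \<or> R d f"
    proof (rule ccontr)
      assume neg: "\<not> ?thesis"
      have dist: "distinct [a, b, c, d, e, f]"
        using pos neg by (auto simp: commute refl)
      \<comment> \<open>Distinctness turns each \<open>R\<close> in \<open>pos\<close> into an arc,
        whose ends are vertices of \<open>G\<close>.\<close>
      have V: "set [a, b, c, d, e, f] \<subseteq> pverts G"
        using pos dist wellformed' by (auto simp: R_def)
      have "\<exists>i \<in> pverts (path_graph 6). \<exists>j \<in> pverts (path_graph 6). i \<noteq> j \<and>
          (R ([a, b, c, d, e, f] ! i) ([a, b, c, d, e, f] ! j) \<noteq> ((i, j) \<in> parcs (path_graph 6)))"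
        using free dist V pair_wf_digraph_path_graph
        by (intro no_induced) (auto simp: P6_bull_free_def path_graph_def)
      then show False
        using pos neg commute
        by (auto simp: path_graph_def numeral_eq_Suc less_Suc_eq)
    qed
  next
    fix a b c d e
    assume pos: "R a b" "R b c" "R a c" "R a d" "R b e"
    show "R d b \<or> R d c \<or> R d e \<or> R e a \<or> R e c"
    proof (rule ccontr)
      assume neg: "\<not> ?thesis"
      then have neg': "\<not> R d b" "\<not> R d c" "\<not> R d e" "\<not> R e a" "\<not> R e c"
        by simp_all
      have dist: "distinct [a, b, c, d, e]"
        using pos neg by (auto simp: commute refl)
      have V: "set [a, b, c, d, e] \<subseteq> pverts G"
        using pos dist wellformed' by (auto simp: R_def)
      have "\<exists>i \<in> pverts bull_graph. \<exists>j \<in> pverts bull_graph. i \<noteq> j \<and>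
          (R ([a, b, c, d, e] ! i) ([a, b, c, d, e] ! j) \<noteq> ((i, j) \<in> parcs bull_graph))"
        using free dist V pair_wf_digraph_bull_graph
        by (intro no_induced) (auto simp: P6_bull_free_def pverts_bull_graph parcs_bull_graph)
      then show False
        using pos pos[THEN symD] neg' neg'[THEN not_symD]
        by (simp add: pverts_bull_graph parcs_bull_graph)
    qed
  qed
qed

section \<open>From an odd antihole in the square to a periodic sequence\<close>

theorem theorem5:
  fixes G :: "'a pair_pre_digraph"
  assumes "pair_graph G"
    and "P6_bull_free G"
    and "\<exists>D. efficient_dominating_set G D"
  shows "odd_antihole_free (graph_square G)"
  unfolding odd_antihole_free_def
proof (intro allI impI notI)
  fix k :: nat assume k: "2 \<le> k"
  define n where "n = 2 * k + 1"
  assume "contains_induced (graph_square G) (graph_complement (cycle_graph (2 * k + 1)))"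
  then obtain g where inj: "inj_on g {..<n}" and V: "g ` {..<n} \<subseteq> pverts G"
    and g: "\<And>i j. \<lbrakk>i < n; j < n\<rbrakk> \<Longrightarrow> (g i, g j) \<in> parcs (graph_square G) \<longleftrightarrow>
      i \<noteq> j \<and> j \<noteq> Suc i mod n \<and> i \<noteq> Suc j mod n"
    by (elim contains_inducedE)
      (simp add: n_def graph_complement_def cycle_graph_def graph_square_def)
  interpret pair_graph G by fact
  obtain D where D: "efficient_dominating_set G D"
    using assms by blast
  interpret bull_P6_free_relation "\<lambda>u v. (u, v) \<in> (parcs G)\<^sup>="
    "\<lambda>v. if v \<in> pverts G then THE d. d \<in> D \<and> vert_dominates G d v else v"
    using assms(1,2) D by (rule bull_P6_free_relation)
  define v where "v i = g (i mod n)" for i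
  have "n \<ge> 5" using k by (simp add: n_def)
  \<comment> \<open>For distinct vertices, \<open>near\<close> is adjacency in the square, which in
    the antihole means being nonconsecutive on the cycle.\<close>
  have adj: "near (v i) (v j) \<longleftrightarrow> j mod n \<noteq> Suc i mod n \<and> i mod n \<noteq> Suc j mod n"
    if "i mod n \<noteq> j mod n" for i j
  proof -
    have less: "i mod n < n" "j mod n < n"
      using \<open>n \<ge> 5\<close> by simp_all
    then have "v i \<in> pverts G" "v j \<in> pverts G" "v i \<noteq> v j"
      using V inj that by (auto simp: v_def inj_on_eq_iff)
    then show ?thesis
      using g[OF less] that graph_square_arcs_iff[OF pair_wf_digraph_axioms, of "v i" "v j"]
      unfolding near_def by (simp add: v_def mod_Suc_eq)
  qed
  show False
  proof (rule no_odd_antihole[of n v])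
    show "odd n" "n \<ge> 5" using \<open>n \<ge> 5\<close> by (simp_all add: n_def)
    show "v (i + n) = v i" for i by (simp add: v_def)
    show "\<not> near (v i) (v (Suc i))" for i
    proof -
      have "i mod n \<noteq> Suc i mod n"
        using \<open>n \<ge> 5\<close> by (auto simp: mod_Suc)
      then show ?thesis using adj by simp
    qed
    show "near (v i) (v (i + l))" if "2 \<le> l" "l + 2 \<le> n" for i l
    proof -
      \<comment> \<open>Applied below, this says that \<open>l\<close> is not congruent to 0, 1 or
        -1 modulo \<open>n\<close>.\<close>
      have *: "(i + a) mod n \<noteq> (i + b) mod n" if "a < b" "b < a + n" for a b
        using that mod_eq_dvd_iff_nat[of "i + a" "i + b" n]
        by (auto simp: dvd_imp_le dest!: dvd_imp_le)
      show ?thesis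
        using adj[of i "i + l"] *[of 0 l] *[of 1 l] *[of 0 "Suc l"] that by simp
    qed
  qed
qed

end
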